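(* Let $p\in(1,2]$, let $N\ge2$ be an even integer and $P\ge 2$ an integer. Let $f_0\in\mathbb R^N$ have nonnegative entries, let $\tilde{\mathbf 1}:=(1,-1,\dots,1,-1)^{T}\in\mathbb R^N$, let $\gamma\in[0,\min_j (f_0)_j)$, and set $f_1:=f_0+\gamma\tilde{\mathbf 1}$. Let $S_{\rm m},S_{\rm f},D_{\rm m},D_{\rm f}$ (periodic boundary conditions), $f^+,f^-$, $J_p$ and $\mathcal C$ be as defined in the context. Then the minimizer of $$\min_{(m,f)\in\mathbb R^{NP}\times\mathbb R^{N(P-1)}}\ \|J_p(S_{\rm m}m,\,S_{\rm f}f+f^+)\|_1+\iota_{\mathcal C}(m,f)$$ is not unique.
   Context: For $n\ge2$ define $D_n\in\mathbb R^{n-1,n}$ by $(D_nx)_j=n(x_{j+1}-x_j)$, $j=1,\dots,n-1$; $D_n^{\rm per}\in\mathbb R^{n,n}$ by $(D_n^{\rm per}x)_1=n(x_1-x_n)$ and $(D_n^{\rm per}x)_j=n(x_j-x_{j-1})$, $j=2,\dots,n$; $S_n\in\mathbb R^{n-1,n}$ by $(S_nx)_j=\frac12(x_j+x_{j+1})$, $j=1,\dots,n-1$; $S_n^{\rm per}\in\mathbb R^{n,n}$ by $(S_n^{\rm per}x)_1=\frac12(x_1+x_n)$ and $(S_n^{\rm per}x)_j=\frac12(x_{j-1}+x_j)$, $j=2,\dots,n$. Let $I_n$ be the $n\times n$ identity matrix and $\otimes$ the Kronecker product, $A\otimes B=(a_{ij}B)_{i,j}$. Set $S_{\rm f}:=S_P^{T}\otimes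 I_N$, $D_{\rm f}:=D_P^{T}\otimes I_N$, and (periodic boundary conditions) $S_{\rm m}:=I_P\otimes (S_N^{\rm per})^{T}$, $D_{\rm m}:=I_P\otimes (D_N^{\rm per})^{T}$. The variables are $m\in\mathbb R^{NP}$ and $f\in\mathbb R^{N(P-1)}$. Set $$f^+:=\tfrac12(f_0^{T},0,f_1^{T})^{T}\in\mathbb R^{NP},\qquad f^-:=P(-f_0^{T},0,f_1^{T})^{T}\in\mathbb R^{NP},$$ where $0$ is the zero row vector of length $N(P-2)$. The function $J_p:\mathbb R\times\mathbb R\to\mathbb R\cup\{+\infty\}$ is $J_p(x,y)=\frac1p\frac{|x|^p}{y^{p-1}}$ if $y>0$, $J_p(0,0)=0$, and $J_p(x,y)=+\infty$ otherwise. For vectors $u,v\in\mathbb R^{NP}$, $J_p(u,v)$ is applied componentwise and $\|J_p(u,v)\|_1$ is the sum of its (nonnegative, possibly infinite) components. $\mathcal C$ is the set of all minimizers $(m,f)\in\mathbb R^{NP}\times\mathbb R^{N(P-1)}$ of $\big\|(D_{\rm m}|D_{\rm f})\binom{m}{f}-f^-\big\|_2^2$, and $\iota_{\mathcal C}$ is its indicator function ($0$ on $\mathcal C$, $+\infty$ outside). *)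

theory Defs
  imports "Jordan_Normal_Form.Matrix" "HOL-Library.Extended_Real"
begin

text \<open>Indices are 0-based throughout. The lemmas following the four matrices below show
  that they act as the difference and averaging operators they encode.\<close>

definition D_mat :: "nat \<Rightarrow> real mat" where
  "D_mat n = mat (n - 1) n (\<lambda>(j, k).
     if k = j + 1 then real n else if k = j then - real n else 0)"

definition S_mat :: "nat \<Rightarrow> real mat" where
  "S_mat n = mat (n - 1) n (\<lambda>(j, k). if k = j \<or> k = j + 1 then 1 / 2 else 0)"

definition cyc_pred :: "nat \<Rightarrow> nat \<Rightarrow> nat" where
  "cyc_pred n j = (if j = 0 then n - 1 else j - 1)"

definition D_per :: "nat \<Rightarrow> real mat" where
  "D_per n = mat n n (\<lambda>(j, k).
     if k = j then real n else if k = cyc_pred n j then - real n else 0)"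

definition S_per :: "nat \<Rightarrow> real mat" where
  "S_per n = mat n n (\<lambda>(j, k). if k = j \<or> k = cyc_pred n j then 1 / 2 else 0)"

lemma two_point_sum:
  fixes g :: "nat \<Rightarrow> real"
  assumes "finite A" "a \<in> A" "b \<in> A" "a \<noteq> b"
    and "\<And>k. k \<in> A \<Longrightarrow> k \<noteq> a \<Longrightarrow> k \<noteq> b \<Longrightarrow> g k = 0"
  shows "sum g A = g a + g b"
proof -
  have "sum g A = sum g {a, b}"
    using assms by (intro sum.mono_neutral_right) auto
  then show ?thesis using assms(4) by simp
qed

lemma D_mat_action:
  assumes "x \<in> carrier_vec n" "j < n - 1"
  shows "(D_mat n *\<^sub>v x) $ j = real n * (x $ (j + 1) - x $ j)"
proof -
  have "(D_mat n *\<^sub>v x) $ j = (\<Sum>k = 0..<n. D_mat n $$ (j, k) * x $ k)"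
    using assms by (simp add: D_mat_def scalar_prod_def)
  also have "\<dots> = D_mat n $$ (j, j + 1) * x $ (j + 1) + D_mat n $$ (j, j) * x $ j"
    using assms by (intro two_point_sum) (auto simp: D_mat_def)
  finally show ?thesis using assms by (simp add: D_mat_def algebra_simps)
qed

lemma S_mat_action:
  assumes "x \<in> carrier_vec n" "j < n - 1"
  shows "(S_mat n *\<^sub>v x) $ j = 1 / 2 * (x $ j + x $ (j + 1))"
proof -
  have "(S_mat n *\<^sub>v x) $ j = (\<Sum>k = 0..<n. S_mat n $$ (j, k) * x $ k)"
    using assms by (simp add: S_mat_def scalar_prod_def)
  also have "\<dots> = S_mat n $$ (j, j) * x $ j + S_mat n $$ (j, j + 1) * x $ (j + 1)"
    using assms by (intro two_point_sum) (auto simp: S_mat_def)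
  finally show ?thesis using assms by (simp add: S_mat_def algebra_simps)
qed

lemma D_per_action:
  assumes "x \<in> carrier_vec n" "2 \<le> n" "j < n"
  shows "(D_per n *\<^sub>v x) $ j = real n * (x $ j - x $ (if j = 0 then n - 1 else j - 1))"
proof -
  have "(D_per n *\<^sub>v x) $ j = (\<Sum>k = 0..<n. D_per n $$ (j, k) * x $ k)"
    using assms by (simp add: D_per_def scalar_prod_def)
  also have "\<dots> = D_per n $$ (j, j) * x $ j
      + D_per n $$ (j, cyc_pred n j) * x $ cyc_pred n j"
    using assms by (intro two_point_sum) (auto simp: D_per_def cyc_pred_def)
  finally show ?thesis using assms by (auto simp: D_per_def cyc_pred_def algebra_simps)
qed

lemma S_per_action:
  assumes "x \<in> carrier_vec n" "2 \<le> n" "j < n"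
  shows "(S_per n *\<^sub>v x) $ j = 1 / 2 * (x $ (if j = 0 then n - 1 else j - 1) + x $ j)"
proof -
  have "(S_per n *\<^sub>v x) $ j = (\<Sum>k = 0..<n. S_per n $$ (j, k) * x $ k)"
    using assms by (simp add: S_per_def scalar_prod_def)
  also have "\<dots> = S_per n $$ (j, j) * x $ j
      + S_per n $$ (j, cyc_pred n j) * x $ cyc_pred n j"
    using assms by (intro two_point_sum) (auto simp: S_per_def cyc_pred_def)
  finally show ?thesis using assms by (auto simp: S_per_def cyc_pred_def algebra_simps)
qed

definition kronecker :: "real mat \<Rightarrow> real mat \<Rightarrow> real mat" (infixl "\<otimes>\<^sub>K" 70) where
  "A \<otimes>\<^sub>K B = mat (dim_row A * dim_row B) (dim_col A * dim_col B) (\<lambda>(i, j).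
     A $$ (i div dim_row B, j div dim_col B) * B $$ (i mod dim_row B, j mod dim_col B))"

definition hcat :: "'a :: zero mat \<Rightarrow> 'a mat \<Rightarrow> 'a mat" where
  "hcat A B = four_block_mat A B (0\<^sub>m 0 (dim_col A)) (0\<^sub>m 0 (dim_col B))"

definition S_f :: "nat \<Rightarrow> nat \<Rightarrow> real mat" where
  "S_f N P = transpose_mat (S_mat P) \<otimes>\<^sub>K 1\<^sub>m N"

definition D_f :: "nat \<Rightarrow> nat \<Rightarrow> real mat" where
  "D_f N P = transpose_mat (D_mat P) \<otimes>\<^sub>K 1\<^sub>m N"

definition S_m :: "nat \<Rightarrow> nat \<Rightarrow> real mat" where
  "S_m N P = 1\<^sub>m P \<otimes>\<^sub>K transpose_mat (S_per N)"

definition D_m :: "nat \<Rightarrow> nat \<Rightarrow> real mat" where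
  "D_m N P = 1\<^sub>m P \<otimes>\<^sub>K transpose_mat (D_per N)"

definition f_plus :: "nat \<Rightarrow> nat \<Rightarrow> real vec \<Rightarrow> real vec \<Rightarrow> real vec" where
  "f_plus N P f0 f1 = (1 / 2) \<cdot>\<^sub>v (f0 @\<^sub>v 0\<^sub>v (N * (P - 2)) @\<^sub>v f1)"

definition f_minus :: "nat \<Rightarrow> nat \<Rightarrow> real vec \<Rightarrow> real vec \<Rightarrow> real vec" where
  "f_minus N P f0 f1 = real P \<cdot>\<^sub>v ((- f0) @\<^sub>v 0\<^sub>v (N * (P - 2)) @\<^sub>v f1)"

definition J :: "real \<Rightarrow> real \<Rightarrow> real \<Rightarrow> ereal" where
  "J p x y = (if y > 0 then ereal (1 / p * (\<bar>x\<bar> powr p / y powr (p - 1)))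
              else if x = 0 \<and> y = 0 then 0 else \<infinity>)"

definition J_norm1 :: "real \<Rightarrow> real vec \<Rightarrow> real vec \<Rightarrow> ereal" where
  "J_norm1 p u v = (\<Sum>i<dim_vec u. J p (u $ i) (v $ i))"

definition norm2_sq :: "real vec \<Rightarrow> real" where
  "norm2_sq v = (\<Sum>i<dim_vec v. (v $ i)\<^sup>2)"

definition mf_space :: "nat \<Rightarrow> nat \<Rightarrow> (real vec \<times> real vec) set" where
  "mf_space N P = carrier_vec (N * P) \<times> carrier_vec (N * (P - 1))"

definition C_set :: "nat \<Rightarrow> nat \<Rightarrow> real vec \<Rightarrow> real vec \<Rightarrow> (real vec \<times> real vec) set" where
  "C_set N P f0 f1 = {z. is_arg_min
     (\<lambda>(m, f). norm2_sq (hcat (D_m N P) (D_f N P) *\<^sub>v (m @\<^sub>v f) - f_minus N P f0 f1))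
     (\<lambda>z. z \<in> mf_space N P) z}"

definition indicator_fun :: "'a set \<Rightarrow> 'a \<Rightarrow> ereal" where
  "indicator_fun A z = (if z \<in> A then 0 else \<infinity>)"

definition objective ::
    "real \<Rightarrow> nat \<Rightarrow> nat \<Rightarrow> real vec \<Rightarrow> real vec \<Rightarrow> real vec \<times> real vec \<Rightarrow> ereal" where
  "objective p N P f0 f1 = (\<lambda>(m, f).
     J_norm1 p (S_m N P *\<^sub>v m) (S_f N P *\<^sub>v f + f_plus N P f0 f1)
       + indicator_fun (C_set N P f0 f1) (m, f))"

definition alt_ones :: "nat \<Rightarrow> real vec" where
  "alt_ones N = vec N (\<lambda>j. (- 1) ^ j)"

end

theory Submission
  imports Defs
begin

text \<open>Since N is even, the alternating vector spans a line in the kernel of the transposed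
  periodic averaging operator and is an eigenvector of the transposed periodic difference operator.
  Hence mass can be moved from f0 to f1 along it at no cost: keep all intermediate densities
  equal to f0 + s * alt_ones and transport only in the first and the last time step. Every s
  with |s| < min f0 yields a feasible point with objective value 0.\<close>

section \<open>Kronecker products and concatenated matrices acting on block vectors\<close>

lemma sum_lessThan_mult:
  fixes g :: "nat \<Rightarrow> 'a :: comm_monoid_add"
  shows "(\<Sum>k<n * q. g k) = (\<Sum>c<n. \<Sum>d<q. g (c * q + d))"
proof -
  have "(\<Sum>k<n * q. g k) = (\<Sum>c<n. sum g {c * q..<c * q + q})"
    using sum.nat_group[of g q n] by (simp add: mult.commute)
  also have "\<dots> = (\<Sum>c<n. \<Sum>d<q. g (c * q + d))"
    using sum.atLeastLessThan_shift_0[of g "c * q" "c * q + q" for c]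
    by (simp add: lessThan_atLeast0)
  finally show ?thesis .
qed

lemma block_index_less:
  fixes a b n q :: nat
  assumes "a < n" "b < q"
  shows "a * q + b < n * q"
proof -
  have "a * q + b < Suc a * q" using assms(2) by simp
  also have "\<dots> \<le> n * q" using assms(1) by (intro mult_le_mono1) simp
  finally show ?thesis .
qed

text \<open>Div and mod split a row index into block and offset, and
  \<open>sum_lessThan_mult\<close> regroups the columns in the same way. When one factor is an
  identity, one of the two sums collapses.\<close>

lemma kronecker_mult_vec_index:
  assumes "a < dim_row A" "b < dim_row B" "v \<in> carrier_vec (dim_col A * dim_col B)"
  shows "((A \<otimes>\<^sub>K B) *\<^sub>v v) $ (a * dim_row B + b) =
    (\<Sum>c<dim_col A. \<Sum>d<dim_col B. A $$ (a, c) * B $$ (b, d) * v $ (c * dim_col B + d))"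
proof -
  have less: "a * dim_row B + b < dim_row A * dim_row B"
    using assms by (intro block_index_less)
  have "((A \<otimes>\<^sub>K B) *\<^sub>v v) $ (a * dim_row B + b) =
      (\<Sum>k<dim_col A * dim_col B. A $$ (a, k div dim_col B) * B $$ (b, k mod dim_col B) * v $ k)"
    using assms less by (simp add: kronecker_def scalar_prod_def lessThan_atLeast0)
  then show ?thesis by (simp add: sum_lessThan_mult)
qed

lemma kronecker_one_mult_vec_index:
  assumes "a < dim_row A" "b < q" "v \<in> carrier_vec (dim_col A * q)"
  shows "((A \<otimes>\<^sub>K 1\<^sub>m q) *\<^sub>v v) $ (a * q + b) = (\<Sum>c<dim_col A. A $$ (a, c) * v $ (c * q + b))"
proof -
  have "((A \<otimes>\<^sub>K 1\<^sub>m q) *\<^sub>v v) $ (a * q + b) =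
      (\<Sum>c<dim_col A. \<Sum>d<q. A $$ (a, c) * (if d = b then v $ (c * q + d) else 0))"
    using kronecker_mult_vec_index[of a A b "1\<^sub>m q" v] assms by (auto intro!: sum.cong)
  then show ?thesis using assms by (simp flip: sum_distrib_left)
qed

lemma one_kronecker_mult_vec_index:
  assumes "a < n" "b < dim_row B" "v \<in> carrier_vec (n * dim_col B)"
  shows "((1\<^sub>m n \<otimes>\<^sub>K B) *\<^sub>v v) $ (a * dim_row B + b) =
    (\<Sum>d<dim_col B. B $$ (b, d) * v $ (a * dim_col B + d))"
proof -
  have "((1\<^sub>m n \<otimes>\<^sub>K B) *\<^sub>v v) $ (a * dim_row B + b) =
      (\<Sum>c<n. \<Sum>d<dim_col B. (if a = c then 1 else 0) * B $$ (b, d) * v $ (c * dim_col B + d))"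
    using kronecker_mult_vec_index[of a "1\<^sub>m n" b B v] assms by simp
  also have "\<dots> = (\<Sum>c<n. if c = a
      then \<Sum>d<dim_col B. B $$ (b, d) * v $ (c * dim_col B + d) else 0)"
    by (intro sum.cong) auto
  also have "\<dots> = (\<Sum>d<dim_col B. B $$ (b, d) * v $ (a * dim_col B + d))"
    using assms(1) by simp
  finally show ?thesis .
qed

text \<open>The lower blocks in \<open>hcat\<close> have no rows, so the four-block product rule
  applies and its lower part is the empty vector.\<close>

lemma hcat_mult_append:
  assumes "A \<in> carrier_mat r n" "B \<in> carrier_mat r k" "x \<in> carrier_vec n" "y \<in> carrier_vec k"
  shows "hcat A B *\<^sub>v (x @\<^sub>v y) = A *\<^sub>v x + B *\<^sub>v y"
proof -
  have "hcat A B *\<^sub>v (x @\<^sub>v y) =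
      (A *\<^sub>v x + B *\<^sub>v y) @\<^sub>v (0\<^sub>m 0 n *\<^sub>v x + 0\<^sub>m 0 k *\<^sub>v y)"
    unfolding hcat_def using assms by (subst four_block_mat_mult_vec) auto
  also have "\<dots> = A *\<^sub>v x + B *\<^sub>v y"
    using assms by (intro eq_vecI) auto
  finally show ?thesis .
qed

section \<open>Sawtooth fluxes and densities constant in time\<close>

definition alt_block_vec :: "nat \<Rightarrow> nat \<Rightarrow> (nat \<Rightarrow> real) \<Rightarrow> real vec" where
  "alt_block_vec N P \<alpha> = vec (N * P) (\<lambda>i. \<alpha> (i div N) * (- 1) ^ (i mod N))"

text \<open>Blocks are time layers and offsets are spatial cells. This is a density at rest; it is
  used with \<open>K = P - 1\<close>, the number of layers strictly between \<open>f0\<close> and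
  \<open>f1\<close>.\<close>

definition const_block_vec :: "nat \<Rightarrow> nat \<Rightarrow> real vec \<Rightarrow> real vec" where
  "const_block_vec N K g = vec (N * K) (\<lambda>i. g $ (i mod N))"

lemma alt_block_vec_index:
  assumes "a < P" "b < N"
  shows "alt_block_vec N P \<alpha> $ (a * N + b) = \<alpha> a * (- 1) ^ b"
  using block_index_less[OF assms] assms by (simp add: alt_block_vec_def mult.commute)

lemma const_block_vec_index:
  assumes "a < K" "b < N"
  shows "const_block_vec N K g $ (a * N + b) = g $ b"
  using block_index_less[OF assms] assms by (simp add: const_block_vec_def mult.commute)

text \<open>Evenness matters at the wrap-around: the last index \<open>N - 1\<close> is odd, so
  returning to 0 flips the sign as every other step does.\<close>

lemma cyc_succ_alternates:
  assumes "even N" "b < N"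
  shows "(- 1 :: real) ^ (if b = N - 1 then 0 else b + 1) = - ((- 1) ^ b)"
  using assms by (cases N) auto

text \<open>Transposition turns the cyclic predecessor into the cyclic successor, so each row takes
  N times an entry minus its successor. The successor has opposite sign, which doubles the
  entry.\<close>

lemma D_m_alt_block_vec_index:
  assumes "2 \<le> N" "even N" "a < P" "b < N"
  shows "(D_m N P *\<^sub>v alt_block_vec N P \<alpha>) $ (a * N + b) = 2 * real N * \<alpha> a * (- 1) ^ b"
proof -
  let ?s = "if b = N - 1 then 0 else b + 1"
  let ?B = "transpose_mat (D_per N)"
  have "(D_m N P *\<^sub>v alt_block_vec N P \<alpha>) $ (a * N + b) =
      (\<Sum>d<N. ?B $$ (b, d) * alt_block_vec N P \<alpha> $ (a * N + d))"
    unfolding D_m_def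
    using one_kronecker_mult_vec_index[of a P b ?B "alt_block_vec N P \<alpha>"] assms
    by (simp add: D_per_def alt_block_vec_def mult.commute)
  also have "\<dots> = (\<Sum>d<N. ?B $$ (b, d) * (\<alpha> a * (- 1) ^ d))"
    using assms by (simp add: alt_block_vec_index)
  also have "\<dots> = ?B $$ (b, b) * (\<alpha> a * (- 1) ^ b) + ?B $$ (b, ?s) * (\<alpha> a * (- 1) ^ ?s)"
    using assms by (intro two_point_sum) (auto simp: D_per_def cyc_pred_def split: if_splits)
  also have "\<dots> = 2 * real N * \<alpha> a * (- 1) ^ b"
    unfolding cyc_succ_alternates[OF assms(2,4)]
    using assms by (auto simp: D_per_def cyc_pred_def)
  finally show ?thesis .
qed

text \<open>Each row averages an entry with its cyclic successor, and the two cancel.\<close>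

lemma S_m_alt_block_vec_index:
  assumes "2 \<le> N" "even N" "a < P" "b < N"
  shows "(S_m N P *\<^sub>v alt_block_vec N P \<alpha>) $ (a * N + b) = 0"
proof -
  let ?s = "if b = N - 1 then 0 else b + 1"
  let ?B = "transpose_mat (S_per N)"
  have "(S_m N P *\<^sub>v alt_block_vec N P \<alpha>) $ (a * N + b) =
      (\<Sum>d<N. ?B $$ (b, d) * alt_block_vec N P \<alpha> $ (a * N + d))"
    unfolding S_m_def
    using one_kronecker_mult_vec_index[of a P b ?B "alt_block_vec N P \<alpha>"] assms
    by (simp add: S_per_def alt_block_vec_def mult.commute)
  also have "\<dots> = (\<Sum>d<N. ?B $$ (b, d) * (\<alpha> a * (- 1) ^ d))"
    using assms by (simp add: alt_block_vec_index)
  also have "\<dots> = ?B $$ (b, b) * (\<alpha> a * (- 1) ^ b) + ?B $$ (b, ?s) * (\<alpha> a * (- 1) ^ ?s)"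
    using assms by (intro two_point_sum) (auto simp: S_per_def cyc_pred_def split: if_splits)
  also have "\<dots> = 0"
    unfolding cyc_succ_alternates[OF assms(2,4)]
    using assms by (auto simp: S_per_def cyc_pred_def)
  finally show ?thesis .
qed

text \<open>Interior rows of the transposed difference contain both P and -P, which cancel on a
  density constant in time. The first and last rows keep only one of them.\<close>

lemma D_f_const_block_vec_index:
  assumes "2 \<le> P" "a < P" "b < N"
  shows "(D_f N P *\<^sub>v const_block_vec N (P - 1) g) $ (a * N + b) =
    (if a = 0 then - real P * g $ b else if a = P - 1 then real P * g $ b else 0)"
proof -
  let ?A = "transpose_mat (D_mat P)"
  have "(D_f N P *\<^sub>v const_block_vec N (P - 1) g) $ (a * N + b) =
      (\<Sum>c<P - 1. ?A $$ (a, c) * const_block_vec N (P - 1) g $ (c * N + b))"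
    unfolding D_f_def
    using kronecker_one_mult_vec_index[of a ?A b N "const_block_vec N (P - 1) g"] assms
    by (simp add: D_mat_def const_block_vec_def mult.commute)
  \<comment> \<open>For \<open>a = 0\<close> truncated subtraction gives \<open>a - 1 = 0\<close>,
    so the inner test removes a spurious term. For \<open>a = P - 1\<close> the index
    \<open>c = a\<close> lies outside the range of summation.\<close>
  also have "\<dots> = (\<Sum>c<P - 1. ((if c = a - 1 then if a = 0 then 0 else real P * g $ b else 0)
      + (if c = a then - real P * g $ b else 0)))"
    using assms by (intro sum.cong) (auto simp: D_mat_def const_block_vec_index)
  also have "\<dots> = (if a = 0 then - real P * g $ b else if a = P - 1 then real P * g $ b else 0)"
    unfolding sum.distrib using assms by auto
  finally show ?thesis .
qed

text \<open>The first and last layers have a single interior neighbour, hence the half weight;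
  \<open>f_plus\<close> supplies the other half from the boundary data.\<close>

lemma S_f_const_block_vec_index:
  assumes "2 \<le> P" "a < P" "b < N"
  shows "(S_f N P *\<^sub>v const_block_vec N (P - 1) g) $ (a * N + b) =
    (if a = 0 \<or> a = P - 1 then g $ b / 2 else g $ b)"
proof -
  let ?A = "transpose_mat (S_mat P)"
  have "(S_f N P *\<^sub>v const_block_vec N (P - 1) g) $ (a * N + b) =
      (\<Sum>c<P - 1. ?A $$ (a, c) * const_block_vec N (P - 1) g $ (c * N + b))"
    unfolding S_f_def
    using kronecker_one_mult_vec_index[of a ?A b N "const_block_vec N (P - 1) g"] assms
    by (simp add: S_mat_def const_block_vec_def mult.commute)
  also have "\<dots> = (\<Sum>c<P - 1. ((if c = a - 1 then if a = 0 then 0 else g $ b / 2 else 0)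
      + (if c = a then g $ b / 2 else 0)))"
    using assms by (intro sum.cong) (auto simp: S_mat_def const_block_vec_index)
  also have "\<dots> = (if a = 0 \<or> a = P - 1 then g $ b / 2 else g $ b)"
    unfolding sum.distrib using assms by auto
  finally show ?thesis .
qed

text \<open>Up to scaling and the sign of the first block, this is the common shape of
  \<open>f_plus\<close> and \<open>f_minus\<close>.\<close>

lemma append_zero_append_index:
  fixes u w :: "real vec"
  assumes "2 \<le> P" "a < P" "b < N" "u \<in> carrier_vec N" "w \<in> carrier_vec N"
  shows "(u @\<^sub>v 0\<^sub>v (N * (P - 2)) @\<^sub>v w) $ (a * N + b) =
    (if a = 0 then u $ b else if a = P - 1 then w $ b else 0)"
proof -
  consider "a = 0" | "a = P - 1" "a \<noteq> 0" | "0 < a" "a < P - 1"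
    using assms(2) by linarith
  then show ?thesis
  proof cases
    case 1
    then show ?thesis using assms by simp
  next
    case 2
    \<comment> \<open>This removes the truncated subtractions, so that the offset of the last block
      can be computed by ring arithmetic.\<close>
    moreover obtain K where "P = K + 2"
      using assms(1) le_add_diff_inverse2 by metis
    ultimately show ?thesis using assms(3-5) by (simp add: algebra_simps)
  next
    case 3
    then obtain a' where a': "a = Suc a'" "a' < P - 2"
      by (cases a) auto
    then have "a' * N + b < (P - 2) * N"
      using assms(3) by (intro block_index_less)
    then show ?thesis using 3 a' assms(3-5) by (simp add: algebra_simps)
  qed
qed

section \<open>Optimality of zero-cost paths\<close>

lemma J_nonneg: "0 < p \<Longrightarrow> 0 \<le> J p x y"
  by (simp add: J_def)

lemma objective_nonneg: "0 < p \<Longrightarrow> 0 \<le> objective p N P f0 f1 z"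
  by (cases z) (auto simp: objective_def J_norm1_def indicator_fun_def intro!: sum_nonneg J_nonneg)

text \<open>The residual is a sum of squares, so a zero residual attains its minimum.\<close>

lemma exact_solution_in_C_set:
  assumes "(m, f) \<in> mf_space N P"
    and "hcat (D_m N P) (D_f N P) *\<^sub>v (m @\<^sub>v f) = f_minus N P f0 f1"
  shows "(m, f) \<in> C_set N P f0 f1"
proof -
  have "norm2_sq (hcat (D_m N P) (D_f N P) *\<^sub>v (m @\<^sub>v f) - f_minus N P f0 f1) = 0"
    unfolding assms(2) by (simp add: norm2_sq_def)
  moreover have "0 \<le> norm2_sq v" for v
    by (simp add: norm2_sq_def sum_nonneg)
  ultimately show ?thesis
    using assms(1) by (auto simp: C_set_def is_arg_min_def not_less)
qed

text \<open>The amplitudes solve the continuity equation along the alternating vector: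
  \<open>2 * N * \<alpha>\<close> must equal \<open>P * s\<close> in the first layer and
  \<open>P * (\<gamma> - s)\<close> in the last. The averaged flux vanishes and the averaged density
  is positive, so the objective is 0, its lower bound.\<close>

lemma sawtooth_path_minimizes:
  fixes N P :: nat and p \<gamma> s :: real
  assumes "1 < p" "2 \<le> N" "even N" "2 \<le> P" "f0 \<in> carrier_vec N"
    and bound: "\<And>j. j < N \<Longrightarrow> \<bar>\<gamma>\<bar> < f0 $ j" "\<And>j. j < N \<Longrightarrow> \<bar>s\<bar> < f0 $ j"
    and f1: "f1 = f0 + \<gamma> \<cdot>\<^sub>v alt_ones N"
  defines "\<alpha> \<equiv> (\<lambda>a. if a = 0 then real P * s / (2 * real N)
      else if a = P - 1 then real P * (\<gamma> - s) / (2 * real N) else 0)"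
  defines "m \<equiv> alt_block_vec N P \<alpha>"
    and "f \<equiv> const_block_vec N (P - 1) (f0 + s \<cdot>\<^sub>v alt_ones N)"
  shows "is_arg_min (objective p N P f0 f1) (\<lambda>z. z \<in> mf_space N P) (m, f)"
proof -
  have carrier: "m \<in> carrier_vec (N * P)" "f \<in> carrier_vec (N * (P - 1))"
    by (auto simp: m_def f_def alt_block_vec_def const_block_vec_def)
  have f1_carrier: "f1 \<in> carrier_vec N"
    using f1 assms(5) by (simp add: alt_ones_def)
  have dims: "D_m N P \<in> carrier_mat (N * P) (N * P)" "D_f N P \<in> carrier_mat (N * P) (N * (P - 1))"
    "S_m N P \<in> carrier_mat (N * P) (N * P)" "S_f N P \<in> carrier_mat (N * P) (N * (P - 1))"
    by (auto simp: D_m_def D_f_def S_m_def S_f_def kronecker_def D_per_def D_mat_def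
        S_per_def S_mat_def mult.commute)
  then have rows: "dim_row (D_m N P) = N * P" "dim_row (D_f N P) = N * P"
    "dim_row (S_m N P) = N * P" "dim_row (S_f N P) = N * P"
    by auto
  obtain K where "P = K + 2"
    using assms(4) le_add_diff_inverse2 by metis
  then have N_P_split: "N + (N * (P - 2) + N) = N * P"
    by (simp add: algebra_simps)
  have block_split: "\<exists>a b. i = a * N + b \<and> a < P \<and> b < N" if "i < N * P" for i
    using that assms(2) by (intro exI[of _ "i div N"] exI[of _ "i mod N"])
      (auto simp: less_mult_imp_div_less mult.commute)
  have continuity: "hcat (D_m N P) (D_f N P) *\<^sub>v (m @\<^sub>v f) = f_minus N P f0 f1"
  proof (rule eq_vecI)
    show "dim_vec (hcat (D_m N P) (D_f N P) *\<^sub>v (m @\<^sub>v f)) = dim_vec (f_minus N P f0 f1)"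
      using hcat_mult_append[OF dims(1,2) carrier] assms(5) f1_carrier N_P_split
      by (simp add: f_minus_def rows)
    fix i assume "i < dim_vec (f_minus N P f0 f1)"
    then have i: "i < N * P"
      using assms(5) f1_carrier N_P_split by (simp add: f_minus_def)
    then obtain a b where ab: "i = a * N + b" "a < P" "b < N" using block_split by blast
    have "(hcat (D_m N P) (D_f N P) *\<^sub>v (m @\<^sub>v f)) $ i =
        (D_m N P *\<^sub>v m) $ i + (D_f N P *\<^sub>v f) $ i"
      using hcat_mult_append[OF dims(1,2) carrier] i by (simp add: rows)
    also have "\<dots> = 2 * real N * \<alpha> a * (- 1) ^ b + (if a = 0 then - real P * (f0 $ b + s * (- 1) ^ b)
        else if a = P - 1 then real P * (f0 $ b + s * (- 1) ^ b) else 0)"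
      using ab assms(2-5) D_m_alt_block_vec_index[of N a P b \<alpha>]
        D_f_const_block_vec_index[of P a b N "f0 + s \<cdot>\<^sub>v alt_ones N"]
      by (simp add: m_def f_def alt_ones_def)
    also have "\<dots> = real P * (if a = 0 then - f0 $ b else if a = P - 1 then f1 $ b else 0)"
      using assms(2-5) ab by (auto simp: \<alpha>_def f1 alt_ones_def field_simps)
    also have "\<dots> = f_minus N P f0 f1 $ i"
      using append_zero_append_index[of P a b N "- f0" f1] assms(2-5) f1_carrier ab i N_P_split
      by (simp add: f_minus_def)
    finally show "(hcat (D_m N P) (D_f N P) *\<^sub>v (m @\<^sub>v f)) $ i = f_minus N P f0 f1 $ i" .
  qed
  have mem: "(m, f) \<in> mf_space N P"
    using carrier by (simp add: mf_space_def)
  have cost: "J p ((S_m N P *\<^sub>v m) $ i) ((S_f N P *\<^sub>v f + f_plus N P f0 f1) $ i) = 0"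
    if i: "i < N * P" for i
  proof -
    obtain a b where ab: "i = a * N + b" "a < P" "b < N" using block_split[OF i] by blast
    have flux: "(S_m N P *\<^sub>v m) $ i = 0"
      using ab assms(2-5) by (simp add: m_def S_m_alt_block_vec_index)
    have alt: "(- 1 :: real) ^ b = 1 \<or> (- 1 :: real) ^ b = - 1"
      by (cases "even b") auto
    have pos: "0 < f0 $ b" "0 < f0 $ b + s * (- 1) ^ b" "0 < f0 $ b + \<gamma> * (- 1) ^ b"
      using bound[OF ab(3)] alt by auto
    \<comment> \<open>Together the half weights give the mean of two consecutive densities. All of
      these are positive by the strict bounds on \<open>\<gamma>\<close> and \<open>s\<close>, which
      puts \<open>J\<close> in its finite branch.\<close>
    have "(S_f N P *\<^sub>v f + f_plus N P f0 f1) $ i =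
        (if a = 0 \<or> a = P - 1 then (f0 $ b + s * (- 1) ^ b) / 2 else f0 $ b + s * (- 1) ^ b)
        + (if a = 0 then f0 $ b else if a = P - 1 then f1 $ b else 0) / 2"
      using append_zero_append_index[of P a b N f0 f1] assms(2-5) f1_carrier ab i N_P_split
        S_f_const_block_vec_index[of P a b N "f0 + s \<cdot>\<^sub>v alt_ones N"]
      by (simp add: f_plus_def f_def alt_ones_def)
    moreover have "\<dots> > 0"
      using pos assms(5) ab by (auto simp: f1 alt_ones_def intro!: add_pos_pos)
    ultimately show ?thesis
      using flux assms(1) by (simp add: J_def)
  qed
  have "objective p N P f0 f1 (m, f) = 0"
    using exact_solution_in_C_set[OF mem continuity] cost
    by (simp add: rows objective_def J_norm1_def indicator_fun_def)
  then show ?thesis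
    using mem objective_nonneg[of p N P f0 f1] assms(1) by (simp add: is_arg_min_def not_less)
qed

theorem mainTheorem3:
  fixes p \<gamma> :: real and N P :: nat and f0 f1 :: "real vec"
  assumes "1 < p" and "p \<le> 2"
    and "2 \<le> N" and "even N" and "2 \<le> P"
    and "f0 \<in> carrier_vec N" and "\<forall>j<N. 0 \<le> f0 $ j"
    and "0 \<le> \<gamma>" and "\<gamma> < (MIN j\<in>{..<N}. f0 $ j)"
    and "f1 = f0 + \<gamma> \<cdot>\<^sub>v alt_ones N"
  shows "\<exists>z z'. z \<noteq> z'
    \<and> is_arg_min (objective p N P f0 f1) (\<lambda>z. z \<in> mf_space N P) z
    \<and> is_arg_min (objective p N P f0 f1) (\<lambda>z. z \<in> mf_space N P) z'"
proof -
  let ?f = "\<lambda>s. const_block_vec N (P - 1) (f0 + s \<cdot>\<^sub>v alt_ones N)"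
  \<comment> \<open>The midpoint of a nonempty open interval: an admissible parameter different from
    \<open>\<gamma>\<close>.\<close>
  define s where "s = (\<gamma> + (MIN j\<in>{..<N}. f0 $ j)) / 2"
  have s: "\<gamma> < s" "s < (MIN j\<in>{..<N}. f0 $ j)"
    using assms(9) by (auto simp: s_def)
  have min_le: "(MIN j\<in>{..<N}. f0 $ j) \<le> f0 $ j" if "j < N" for j
    using that by (intro Min_le) auto
  have \<gamma>_bound: "\<bar>\<gamma>\<bar> < f0 $ j" if "j < N" for j
    using min_le[OF that] assms(8,9) by simp
  have s_bound: "\<bar>s\<bar> < f0 $ j" if "j < N" for j
    using min_le[OF that] assms(8) s by simp
  \<comment> \<open>The alternating vector starts with 1, so the first entry recovers the parameter
    and separates the two densities.\<close>
  have first_entry: "?f t $ 0 = f0 $ 0 + t" for t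
    using const_block_vec_index[of 0 "P - 1" 0 N] assms(3,5,6) by (simp add: alt_ones_def)
  have "?f \<gamma> \<noteq> ?f s"
  proof
    assume "?f \<gamma> = ?f s"
    then show False using first_entry[of \<gamma>] first_entry[of s] s(1) by simp
  qed
  \<comment> \<open>The parameter \<open>\<gamma>\<close> makes the whole change in the first time
    step; \<open>s > \<gamma>\<close> overshoots and is corrected in the last one.\<close>
  then show ?thesis
    using sawtooth_path_minimizes[OF assms(1,3-6) \<gamma>_bound \<gamma>_bound assms(10)]
      sawtooth_path_minimizes[OF assms(1,3-6) \<gamma>_bound s_bound assms(10)]
    by blast
qed

end
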